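(* The degree is a homotopy invariant: if $f,f':S^1_{\mathbb{Q}}\to S^1_{\mathbb{Q}}$ are homotopic continuous baseleaf preserving maps, then $\deg(f)=\deg(f')$.
   Context: The adelic solenoid is the inverse limit $S^1_{\mathbb{Q}}=\varprojlim S^1$ of circles $S^1=\{z\in\mathbb{C}:|z|=1\}$ indexed by positive integers ordered by divisibility, with bonding maps $p_{n,m}(z)=z^{m/n}$ for $n\mid m$. The baseleaf is the image of the injective group morphism $\nu:\mathbb{R}\to S^1_{\mathbb{Q}}$, $\nu(t)=(e^{it/n})_{n\ge1}$. A map $f:S^1_{\mathbb{Q}}\to S^1_{\mathbb{Q}}$ is baseleaf preserving if $f(\nu(\mathbb{R}))\subset\nu(\mathbb{R})$. A function $h:\mathbb{R}\to\mathbb{R}$ is limit periodic if for every $\varepsilon>0$ there is a natural number $N\geq 1$ such that $|h(x+2\pi n)-h(x)|<\varepsilon$ for every $x\in\mathbb{R}$ and every $n\in N\mathbb{Z}$. For a continuous baseleaf preserving $f$, let $f_0:\mathbb{R}\to\mathbb{R}$ be the function with $f\circ\nu=\nu\circ f_0$. There are a unique rational number $q$ and a unique continuous limit periodic function $h:\mathbb{R}\to\mathbb{R}$ with $f_0(x)=qx+h(x)$ for all $x$; the degree of $f$ is $\deg(f):=q$. *)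

theory Defs
  imports "HOL-Analysis.Analysis"
begin

text \<open>
  Points of the solenoid are families indexed by the positive integers, encoded as functions on
  \<^typ>\<open>nat\<close> that are undefined at the index 0 (the extensional functions of
  \<^const>\<open>product_topology\<close>). The inverse limit carries the subspace topology of the product.
\<close>

definition solenoid :: "(nat \<Rightarrow> complex) topology" where
  "solenoid = subtopology
     (product_topology (\<lambda>_. top_of_set (sphere (0::complex) 1)) {1..})
     {z. \<forall>n\<ge>1. \<forall>m\<ge>1. n dvd m \<longrightarrow> z n = z m ^ (m div n)}"

definition baseleaf_map :: "real \<Rightarrow> nat \<Rightarrow> complex" where
  "baseleaf_map t = (\<lambda>n\<in>{1..}. exp (\<i> * complex_of_real (t / real n)))"

definition baseleaf_preserving :: "((nat \<Rightarrow> complex) \<Rightarrow> nat \<Rightarrow> complex) \<Rightarrow> bool" where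
  "baseleaf_preserving f \<longleftrightarrow> f ` range baseleaf_map \<subseteq> range baseleaf_map"

definition limit_periodic :: "(real \<Rightarrow> real) \<Rightarrow> bool" where
  "limit_periodic h \<longleftrightarrow>
     (\<forall>\<epsilon>>0. \<exists>N::nat. N \<ge> 1 \<and>
        (\<forall>x. \<forall>n::int. int N dvd n \<longrightarrow> \<bar>h (x + 2 * pi * of_int n) - h x\<bar> < \<epsilon>))"

text \<open>
  The two definite descriptions below are meaningful for continuous baseleaf preserving maps:
  the lift is unique because \<^const>\<open>baseleaf_map\<close> is injective, and the linear coefficient of
  the lift is unique because continuous limit periodic functions are bounded.
\<close>

definition leaf_lift :: "((nat \<Rightarrow> complex) \<Rightarrow> nat \<Rightarrow> complex) \<Rightarrow> real \<Rightarrow> real" where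
  "leaf_lift f = (THE f0. f \<circ> baseleaf_map = baseleaf_map \<circ> f0)"

definition solenoid_degree :: "((nat \<Rightarrow> complex) \<Rightarrow> nat \<Rightarrow> complex) \<Rightarrow> rat" where
  "solenoid_degree f =
     (THE q. \<exists>h. continuous_on UNIV h \<and> limit_periodic h \<and>
        (\<forall>x. leaf_lift f x = of_rat q * x + h x))"

end

theory Submission imports Defs begin

text \<open>
  A homotopy from \<open>f\<close> to \<open>f'\<close> moves every point along its own leaf: there is a continuous real
  function \<open>\<theta>\<close> on the solenoid with \<open>f' z = f z \<cdot> \<nu>(\<theta> z)\<close>, where \<open>\<nu>\<close> is the baseleaf
  parametrisation. Two stages of the homotopy at nearby times are related in this way, since the
  quotient of their first coordinates stays in the right half-plane and hence has a continuous
  argument \<open>\<theta>\<close>, and the quotient of their \<open>n\<close>-th coordinates is an \<open>n\<close>-th root of that quotient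
  which starts at 1 and varies continuously with time, so it must be \<open>exp (\<i> \<theta> / n)\<close>
  (\<open>leafwise_translate_nearby_stages\<close>). Nearness in time can be chosen uniformly in the point
  because the solenoid is compact. Being related is an equivalence relation and \<open>[0,1]\<close> is
  connected, so the two ends of the homotopy are related as well
  (\<open>homotopic_imp_leafwise_translate\<close>).

  On the baseleaf, injectivity of \<open>\<nu>\<close> turns \<open>f' z = f z \<cdot> \<nu>(\<theta> z)\<close> into \<open>f'\<^sub>0 = f\<^sub>0 + \<theta> \<circ> \<nu>\<close> for
  the lifts. The difference \<open>\<theta> \<circ> \<nu>\<close> is limit periodic because \<open>\<theta>\<close> is uniformly continuous on
  the compact group and \<open>\<nu>(2 \<pi> n)\<close> is close to the identity when \<open>n\<close> is divisible by many
  integers (\<open>limit_periodic_comp_baseleaf_map\<close>). Adding a continuous limit periodic function does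
  not change which \<open>q\<close> can serve as the linear coefficient of a lift, so the two definite
  descriptions of the degree range over the same condition and agree.
\<close>

section \<open>The solenoid as a compact topological group\<close>

text \<open>
  Writing the index \<open>m\<close> divisible by \<open>n\<close> as \<open>n * k\<close> and putting the power on the left turns the
  inverse limit condition into a terminating rewrite rule.
\<close>

lemma in_topspace_solenoid_iff:
  "z \<in> topspace solenoid \<longleftrightarrow>
     z \<in> extensional {1..} \<and> (\<forall>n\<ge>1. norm (z n) = 1) \<and> (\<forall>n\<ge>1. \<forall>k\<ge>1. z (n * k) ^ k = z n)"
proof -
  have "(\<forall>n\<ge>1. \<forall>m\<ge>1. n dvd m \<longrightarrow> z n = z m ^ (m div n)) \<longleftrightarrow> (\<forall>n\<ge>1. \<forall>k\<ge>1. z (n * k) ^ k = z n)"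
    (is "?D \<longleftrightarrow> ?K")
  proof
    assume D: ?D
    show ?K
    proof (intro allI impI)
      fix n k :: nat assume "n \<ge> 1" "k \<ge> 1"
      then show "z (n * k) ^ k = z n"
        using D[rule_format, of n "n * k"] by simp
    qed
  next
    assume K: ?K
    show ?D
    proof (intro allI impI)
      fix n m :: nat assume "n \<ge> 1" "m \<ge> 1" "n dvd m"
      then obtain k where "m = n * k" by auto
      then show "z n = z m ^ (m div n)"
        using K[rule_format, of n k] \<open>n \<ge> 1\<close> \<open>m \<ge> 1\<close> by (cases k) auto
    qed
  qed
  moreover have "z \<in> topspace (product_topology (\<lambda>_. top_of_set (sphere (0::complex) 1)) {1..}) \<longleftrightarrow>
      z \<in> extensional {1..} \<and> (\<forall>n\<ge>1. norm (z n) = 1)"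
    by (auto simp: PiE_iff)
  ultimately show ?thesis
    unfolding solenoid_def topspace_subtopology Int_iff mem_Collect_eq by argo
qed

lemma norm_solenoid [simp]: "z \<in> topspace solenoid \<Longrightarrow> n \<ge> 1 \<Longrightarrow> norm (z n) = 1"
  by (simp add: in_topspace_solenoid_iff)

lemma solenoid_power: "z \<in> topspace solenoid \<Longrightarrow> n \<ge> 1 \<Longrightarrow> z n ^ n = z 1"
  unfolding in_topspace_solenoid_iff by (metis le_refl mult_1)

lemma continuous_map_into_solenoid_iff:
  "continuous_map X solenoid f \<longleftrightarrow>
     (\<forall>n\<ge>1. continuous_map X euclidean (\<lambda>x. f x n)) \<and> f ` topspace X \<subseteq> topspace solenoid"
  (is "_ \<longleftrightarrow> ?R")
proof
  let ?P = "product_topology (\<lambda>_::nat. top_of_set (sphere (0::complex) 1)) {1..}"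
  assume f: "continuous_map X solenoid f"
  then have "continuous_map X ?P f"
    unfolding solenoid_def continuous_map_in_subtopology by blast
  then have "\<forall>n\<ge>1. continuous_map X euclidean (\<lambda>x. f x n)"
    by (simp add: continuous_map_componentwise continuous_map_in_subtopology)
  then show ?R using continuous_map_image_subset_topspace[OF f] by blast
next
  assume R: ?R
  then have "f x \<in> topspace solenoid" if "x \<in> topspace X" for x
    using that by blast
  then have "f x \<in> extensional {1..} \<and> (\<forall>n\<ge>1. norm (f x n) = 1)" if "x \<in> topspace X" for x
    using that unfolding in_topspace_solenoid_iff by blast
  then have "continuous_map X (product_topology (\<lambda>_::nat. top_of_set (sphere (0::complex) 1)) {1..}) f"
    using R by (auto simp: continuous_map_componentwise continuous_map_in_subtopology)
  moreover have "f \<in> topspace X \<rightarrow> {z. \<forall>n\<ge>1. \<forall>m\<ge>1. n dvd m \<longrightarrow> z n = z m ^ (m div n)}"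
    using R unfolding solenoid_def topspace_subtopology by blast
  ultimately show "continuous_map X solenoid f"
    unfolding solenoid_def continuous_map_in_subtopology by blast
qed

lemma continuous_map_solenoid_coordinate:
  "continuous_map X solenoid f \<Longrightarrow> n \<ge> 1 \<Longrightarrow> continuous_map X euclidean (\<lambda>x. f x n)"
  by (simp add: continuous_map_into_solenoid_iff)

text \<open>The solenoid is cut out of a compact product of circles by closed conditions.\<close>

lemma compact_space_solenoid: "compact_space solenoid"
proof -
  let ?P = "product_topology (\<lambda>_::nat. top_of_set (sphere (0::complex) 1)) {1..}"
  let ?E = "\<lambda>n m. {z \<in> topspace ?P. z n = z m ^ (m div n)}"
  have coord: "continuous_map ?P euclidean (\<lambda>z. z n)" if "n \<ge> 1" for n
    using continuous_map_product_projection[of n "{1..}" "\<lambda>_::nat. top_of_set (sphere (0::complex) 1)"] that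
    by (auto simp: continuous_map_in_subtopology)
  have "closedin ?P (?E n m)" if "n \<ge> 1" "m \<ge> 1" for n m
  proof (rule closedin_continuous_maps_eq)
    show "continuous_map ?P euclidean (\<lambda>z. z m ^ (m div n))"
      using coord[OF that(2)] by (simp add: continuous_map_atin tendsto_power)
  qed (use coord that in auto)
  then have "closedin ?P (\<Inter>(n,m)\<in>{(n,m). n \<ge> 1 \<and> m \<ge> 1 \<and> n dvd m}. ?E n m)"
    by (intro closedin_INT) auto
  also have "(\<Inter>(n,m)\<in>{(n,m). n \<ge> 1 \<and> m \<ge> 1 \<and> n dvd m}. ?E n m)
      = topspace ?P \<inter> {z. \<forall>n\<ge>1. \<forall>m\<ge>1. n dvd m \<longrightarrow> z n = z m ^ (m div n)}"
    by auto
  finally have "closedin ?P \<dots>" .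
  moreover have "compact_space ?P"
    by (simp add: compact_space_product_topology compact_space_subtopology)
  ultimately have "compact_space (subtopology ?P (topspace ?P \<inter> 
       {z. \<forall>n\<ge>1. \<forall>m\<ge>1. n dvd m \<longrightarrow> z n = z m ^ (m div n)}))"
    using closedin_compact_space compact_space_subtopology by blast
  then show ?thesis
    by (simp only: solenoid_def subtopology_restrict)
qed

lemma baseleaf_map_coordinate [simp]:
  "n \<ge> 1 \<Longrightarrow> baseleaf_map t n = exp (\<i> * complex_of_real (t / real n))"
  by (simp add: baseleaf_map_def)

lemma baseleaf_map_in_solenoid [simp]: "baseleaf_map t \<in> topspace solenoid"
proof -
  have "exp (\<i> * complex_of_real (t / real (n * k))) ^ k = exp (\<i> * complex_of_real (t / real n))"
    if "n \<ge> 1" "k \<ge> 1" for n k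
    using that by (simp flip: exp_of_nat_mult)
  then show ?thesis
    by (auto simp: in_topspace_solenoid_iff baseleaf_map_def)
qed

lemma continuous_map_baseleaf_map: "continuous_map euclideanreal solenoid baseleaf_map"
  by (auto simp: continuous_map_into_solenoid_iff intro!: continuous_intros)

text \<open>
  Two parameters closer than \<open>2 \<pi> n\<close> are already distinguished by the \<open>n\<close>-th coordinate.
\<close>

lemma inj_baseleaf_map: "inj baseleaf_map"
proof (rule injI)
  fix s t assume eq: "baseleaf_map s = baseleaf_map t"
  obtain n :: nat where n: "\<bar>s - t\<bar> < real n" using reals_Archimedean2 by blast
  then have "n \<ge> 1" by (cases n) auto
  have "exp (\<i> * complex_of_real (s / n)) = exp (\<i> * complex_of_real (t / n))"
    using fun_cong[OF eq, of n] \<open>n \<ge> 1\<close> by simp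
  moreover have "\<bar>Im (\<i> * complex_of_real (s / n)) - Im (\<i> * complex_of_real (t / n))\<bar> < 2 * pi"
  proof -
    have "\<bar>s / n - t / n\<bar> = \<bar>s - t\<bar> / n"
      by (simp flip: diff_divide_distrib)
    also have "\<dots> < 1"
      using n \<open>n \<ge> 1\<close> by simp
    finally have "\<bar>s / n - t / n\<bar> < 1" .
    then show ?thesis using pi_gt3 by simp
  qed
  ultimately have "\<i> * complex_of_real (s / n) = \<i> * complex_of_real (t / n)"
    by (rule exp_complex_eqI[rotated])
  then show "s = t"
    using \<open>n \<ge> 1\<close> by (simp add: complex_eq_iff)
qed

text \<open>
  The group operation. The restriction keeps products undefined at the index 0, as points of the
  solenoid must be.
\<close>

definition solenoid_mult :: "(nat \<Rightarrow> complex) \<Rightarrow> (nat \<Rightarrow> complex) \<Rightarrow> nat \<Rightarrow> complex" where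
  "solenoid_mult w z = (\<lambda>n\<in>{1..}. w n * z n)"

lemma continuous_map_solenoid_mult:
  "continuous_map (prod_topology solenoid solenoid) solenoid (\<lambda>(w, z). solenoid_mult w z)"
proof -
  have "continuous_map (prod_topology solenoid solenoid) euclidean (\<lambda>p. fst p n * snd p n)"
    if "n \<ge> 1" for n
  proof -
    have "continuous_map (prod_topology solenoid solenoid) euclidean (\<lambda>p. fst p n)"
         "continuous_map (prod_topology solenoid solenoid) euclidean (\<lambda>p. snd p n)"
      using that by (auto intro!: continuous_map_solenoid_coordinate continuous_intros)
    then show ?thesis by (simp add: continuous_map_atin tendsto_mult)
  qed
  then show ?thesis
    unfolding continuous_map_into_solenoid_iff
    by (auto simp: solenoid_mult_def split_beta in_topspace_solenoid_iff norm_mult power_mult_distrib)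
qed

lemma solenoid_mult_baseleaf_map:
  "solenoid_mult (baseleaf_map s) (baseleaf_map t) = baseleaf_map (s + t)"
  by (auto simp: solenoid_mult_def baseleaf_map_def add_divide_distrib exp_add algebra_simps)

section \<open>Functions on the solenoid are limit periodic along the baseleaf\<close>

text \<open>
  Translation by an element \<open>w\<close> of the group changes \<open>\<theta>\<close> by less than \<open>\<epsilon>\<close> uniformly once \<open>w\<close> is in
  a suitable neighbourhood \<open>U\<close> of the identity: this is the tube lemma around the slice of the
  identity. Such a \<open>U\<close> contains a neighbourhood that restricts finitely many coordinates
  only, and \<open>\<nu>(2 \<pi> n)\<close> has \<open>i\<close>-th coordinate 1 whenever \<open>i\<close> divides \<open>n\<close>, so the product of the restricted indices is a period.
\<close>

lemma limit_periodic_comp_baseleaf_map: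
  assumes \<theta>: "continuous_map solenoid euclideanreal \<theta>"
  shows "limit_periodic (\<theta> \<circ> baseleaf_map)"
  unfolding limit_periodic_def
proof (intro allI impI)
  fix \<epsilon> :: real assume "\<epsilon> > 0"
  let ?SS = "prod_topology solenoid solenoid"
  let ?d = "\<lambda>p. \<theta> (solenoid_mult (fst p) (snd p)) - \<theta> (snd p)"
  have "continuous_map ?SS euclideanreal ?d"
    using continuous_map_compose[OF continuous_map_solenoid_mult \<theta>]
      continuous_map_compose[OF continuous_map_snd \<theta>]
    by (auto intro!: continuous_map_diff simp: o_def split_beta)
  then have "openin ?SS {p \<in> topspace ?SS. ?d p \<in> {-\<epsilon><..<\<epsilon>}}"
    by (rule openin_continuous_map_preimage) auto
  moreover have "{baseleaf_map 0} \<times> topspace solenoid \<subseteq> {p \<in> topspace ?SS. ?d p \<in> {-\<epsilon><..<\<epsilon>}}"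
  proof -
    have "solenoid_mult (baseleaf_map 0) z = z" if "z \<in> topspace solenoid" for z
      using that by (auto simp: solenoid_mult_def in_topspace_solenoid_iff fun_eq_iff extensional_def)
    then show ?thesis using \<open>\<epsilon> > 0\<close> by auto
  qed
  ultimately obtain U V where U: "openin solenoid U" "baseleaf_map 0 \<in> U"
    and V: "topspace solenoid \<subseteq> V" and UV: "U \<times> V \<subseteq> {p \<in> topspace ?SS. ?d p \<in> {-\<epsilon><..<\<epsilon>}}"
    using tube_lemma_right[of solenoid solenoid "{p \<in> topspace ?SS. ?d p \<in> {-\<epsilon><..<\<epsilon>}}"
        "topspace solenoid" "baseleaf_map 0"]
      compact_space_solenoid[unfolded compact_space_def] baseleaf_map_in_solenoid by blast
  obtain N where N: "N \<ge> 1" "\<And>n. int N dvd n \<Longrightarrow> baseleaf_map (2 * pi * of_int n) \<in> U"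
  proof -
    let ?P = "product_topology (\<lambda>_::nat. top_of_set (sphere (0::complex) 1)) {1..}"
    let ?C = "{z :: nat \<Rightarrow> complex. \<forall>n\<ge>1. \<forall>m\<ge>1. n dvd m \<longrightarrow> z n = z m ^ (m div n)}"
    from U(1) obtain W where W: "openin ?P W" and "U = W \<inter> ?C"
      unfolding solenoid_def openin_subtopology by blast
    moreover have "topspace solenoid = topspace ?P \<inter> ?C"
      unfolding solenoid_def topspace_subtopology ..
    ultimately have U_eq: "U = W \<inter> topspace solenoid"
      using openin_subset[OF W] by blast
    with U(2) W obtain B where B: "finite {i \<in> {1..}. B i \<noteq> topspace (top_of_set (sphere (0::complex) 1))}"
      "baseleaf_map 0 \<in> Pi\<^sub>E {1..} B" "Pi\<^sub>E {1..} B \<subseteq> W"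
      unfolding openin_product_topology_alt by blast
    define F where "F = {i \<in> {1::nat..}. B i \<noteq> topspace (top_of_set (sphere (0::complex) 1))}"
    have "\<Prod>F \<ge> 1" using B(1) by (auto simp: F_def Suc_le_eq intro!: prod_pos)
    moreover have "baseleaf_map (2 * pi * of_int n) \<in> U" if n: "int (\<Prod>F) dvd n" for n
    proof -
      have "baseleaf_map (2 * pi * of_int n) i \<in> B i" if i: "i \<ge> 1" for i
      proof (cases "i \<in> F")
        case True
        then have "int i dvd n" using B(1) n unfolding F_def[symmetric]
          by (meson dvd_prodI dvd_trans int_dvd_int_iff)
        then obtain k where "n = int i * k" by auto
        with i have "baseleaf_map (2 * pi * of_int n) i = exp (of_int (2 * k) * pi * \<i>)"
          by (simp add: mult_ac)
        also have "\<dots> = baseleaf_map 0 i"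
          using i by (simp add: exp_eq_1)
        finally show ?thesis using B(2) i by (auto simp: PiE_iff)
      next
        case False
        then show ?thesis using i by (simp add: F_def)
      qed
      moreover have "baseleaf_map (2 * pi * of_int n) \<in> extensional {1..}"
        by (simp add: baseleaf_map_def)
      ultimately have "baseleaf_map (2 * pi * of_int n) \<in> Pi\<^sub>E {1..} B"
        by (auto simp: PiE_iff)
      then show ?thesis using B(3) by (auto simp: U_eq)
    qed
    ultimately show thesis using that by blast
  qed
  have "\<bar>\<theta> (baseleaf_map (x + 2 * pi * of_int n)) - \<theta> (baseleaf_map x)\<bar> < \<epsilon>"
    if "int N dvd n" for x n
  proof -
    have "(baseleaf_map (2 * pi * of_int n), baseleaf_map x) \<in> U \<times> V"
      using N(2)[OF that] V by auto
    then show ?thesis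
      using UV by (auto simp: solenoid_mult_baseleaf_map add.commute)
  qed
  then show "\<exists>N\<ge>1. \<forall>x n. int N dvd n \<longrightarrow>
      \<bar>(\<theta> \<circ> baseleaf_map) (x + 2 * pi * of_int n) - (\<theta> \<circ> baseleaf_map) x\<bar> < \<epsilon>"
    using N(1) by auto
qed

lemma limit_periodic_add:
  assumes "limit_periodic g" "limit_periodic h"
  shows "limit_periodic (\<lambda>x. g x + h x)"
  unfolding limit_periodic_def
proof (intro allI impI)
  fix \<epsilon> :: real assume "\<epsilon> > 0"
  then have "\<epsilon> / 2 > 0" by simp
  from assms[unfolded limit_periodic_def, rule_format, OF this]
  obtain M N :: nat where "M \<ge> 1" "N \<ge> 1"
    and M: "\<And>x n. int M dvd n \<Longrightarrow> \<bar>g (x + 2 * pi * of_int n) - g x\<bar> < \<epsilon> / 2"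
    and N: "\<And>x n. int N dvd n \<Longrightarrow> \<bar>h (x + 2 * pi * of_int n) - h x\<bar> < \<epsilon> / 2"
    by blast
  have "\<bar>g (x + 2 * pi * of_int n) + h (x + 2 * pi * of_int n) - (g x + h x)\<bar> < \<epsilon>"
    if "int (M * N) dvd n" for x n
  proof -
    have "int M dvd n" "int N dvd n"
      using that by (auto intro: dvd_mult_left dvd_mult_right)
    then show ?thesis using M[of n x] N[of n x] by linarith
  qed
  then show "\<exists>N\<ge>1. \<forall>x n. int N dvd n \<longrightarrow>
      \<bar>g (x + 2 * pi * of_int n) + h (x + 2 * pi * of_int n) - (g x + h x)\<bar> < \<epsilon>"
    using \<open>M \<ge> 1\<close> \<open>N \<ge> 1\<close> by (intro exI[of _ "M * N"]) auto
qed

section \<open>Homotopic maps differ by a translation along the leaves\<close>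

text \<open>
  The maps differ by a continuous motion along the leaves: the \<open>n\<close>-th coordinate of \<open>\<nu>(\<theta> z)\<close> is
  \<open>exp (\<i> \<theta> z / n)\<close>. Values are compared at the positive indices of points of the solenoid, since
  a homotopy says nothing about the remaining arguments.
\<close>

definition leafwise_translate ::
    "((nat \<Rightarrow> complex) \<Rightarrow> nat \<Rightarrow> complex) \<Rightarrow> ((nat \<Rightarrow> complex) \<Rightarrow> nat \<Rightarrow> complex) \<Rightarrow> bool" where
  "leafwise_translate f g \<longleftrightarrow>
     (\<exists>\<theta>. continuous_map solenoid euclideanreal \<theta> \<and>
        (\<forall>z\<in>topspace solenoid. \<forall>n\<ge>1. g z n = f z n * exp (\<i> * complex_of_real (\<theta> z / real n))))"

lemma leafwise_translate_sym:
  assumes "leafwise_translate f g" shows "leafwise_translate g f"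
proof -
  obtain \<theta> where \<theta>: "continuous_map solenoid euclideanreal \<theta>"
    "\<forall>z\<in>topspace solenoid. \<forall>n\<ge>1. g z n = f z n * exp (\<i> * complex_of_real (\<theta> z / real n))"
    using assms leafwise_translate_def by blast
  then have "continuous_map solenoid euclideanreal (\<lambda>z. - \<theta> z)"
    by (intro continuous_intros)
  with \<theta>(2) show ?thesis
    unfolding leafwise_translate_def by (intro exI[of _ "\<lambda>z. - \<theta> z"]) (auto simp: exp_minus)
qed

lemma leafwise_translate_trans:
  assumes "leafwise_translate f g" "leafwise_translate g k"
  shows "leafwise_translate f k"
proof -
  obtain \<theta> \<eta> where *: "continuous_map solenoid euclideanreal \<theta>" "continuous_map solenoid euclideanreal \<eta>"
    "\<forall>z\<in>topspace solenoid. \<forall>n\<ge>1. g z n = f z n * exp (\<i> * complex_of_real (\<theta> z / real n))"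
    "\<forall>z\<in>topspace solenoid. \<forall>n\<ge>1. k z n = g z n * exp (\<i> * complex_of_real (\<eta> z / real n))"
    using assms leafwise_translate_def by metis
  then have "continuous_map solenoid euclideanreal (\<lambda>z. \<theta> z + \<eta> z)"
    by (intro continuous_intros)
  with * show ?thesis
    unfolding leafwise_translate_def
    by (intro exI[of _ "\<lambda>z. \<theta> z + \<eta> z"]) (auto simp: exp_add add_divide_distrib distrib_left)
qed

text \<open>
  A continuous choice of \<open>n\<close>-th roots along a connected set is determined by one of its values.
  Dividing \<open>r\<close> by the \<open>n\<close>-th root of \<open>w\<close> given by the principal logarithm leaves a continuous
  function with values among the finitely many \<open>n\<close>-th roots of unity, which is constant.
\<close>

lemma root_of_path_in_right_half_plane:
  fixes r w :: "real \<Rightarrow> complex"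
  assumes S: "connected S" "a \<in> S" "b \<in> S" and n: "n \<ge> 1"
    and r: "continuous_on S r" "\<And>u. u \<in> S \<Longrightarrow> norm (r u) = 1" "r a = 1"
    and root: "\<And>u. u \<in> S \<Longrightarrow> r u ^ n = w u"
    and w: "continuous_on S w" "\<And>u. u \<in> S \<Longrightarrow> Re (w u) > 0"
  shows "r b = exp (\<i> * complex_of_real (Im (Ln (w b)) / real n))"
proof -
  define \<phi> where "\<phi> u = r u * exp (- (\<i> * complex_of_real (Im (Ln (w u)) / real n)))" for u
  have "w u \<notin> \<real>\<^sub>\<le>\<^sub>0" if "u \<in> S" for u
    using w(2)[OF that] by (auto simp: complex_nonpos_Reals_iff)
  then have "continuous_on S \<phi>"
    unfolding \<phi>_def using r(1) w(1) n by (intro continuous_intros) auto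
  moreover have unit: "\<phi> u ^ n = 1" if "u \<in> S" for u
  proof -
    have nw: "norm (w u) = 1" using root[OF that] r(2)[OF that] by (metis norm_power power_one)
    then have "w u \<noteq> 0" by auto
    have "Ln (w u) = \<i> * complex_of_real (Im (Ln (w u)))"
      using nw \<open>w u \<noteq> 0\<close> by (simp add: complex_eq_iff Re_Ln)
    then have "w u = exp (\<i> * complex_of_real (Im (Ln (w u))))"
      using exp_Ln[OF \<open>w u \<noteq> 0\<close>] by metis
    moreover have "exp (- (\<i> * complex_of_real (Im (Ln (w u)) / real n))) ^ n
        = exp (- (\<i> * complex_of_real (Im (Ln (w u)))))"
      using n by (simp flip: exp_of_nat_mult)
    ultimately show ?thesis
      unfolding \<phi>_def power_mult_distrib root[OF that] by (metis exp_minus_inverse)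
  qed
  moreover have "finite (\<phi> ` S)"
    by (rule finite_subset[OF _ finite_roots_unity[OF n, where 'a = complex]]) (use unit in auto)
  ultimately have "\<phi> constant_on S"
    using continuous_finite_range_constant S(1) by blast
  then have "\<phi> b = \<phi> a" using S by (auto simp: constant_on_def)
  also have "\<dots> = 1"
    using root[OF S(2)] r(3) by (simp add: \<phi>_def flip: root[OF S(2)])
  finally show ?thesis
    by (simp add: \<phi>_def exp_minus field_simps)
qed

text \<open>
  A lift is read off from the first coordinate only, with the principal branch of the logarithm;
  the other coordinates follow because the homotopy joins the two stages continuously.
\<close>

lemma leafwise_translate_nearby_stages:
  assumes h: "continuous_map (prod_topology (top_of_set {0..1::real}) solenoid) solenoid h"
    and a: "a \<in> {0..1}"
  shows "\<exists>T. openin (top_of_set {0..1}) T \<and> a \<in> T \<and>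
           (\<forall>s\<in>T. leafwise_translate (\<lambda>z. h (a, z)) (\<lambda>z. h (s, z)))"
proof -
  let ?X = "prod_topology (top_of_set {0..1::real}) solenoid"
  \<comment> \<open>the displacement since time \<open>a\<close> in the \<open>n\<close>-th coordinate\<close>
  define q where "q n p = h p n / h (a, snd p) n" for n p
  have hS: "h (s, z) \<in> topspace solenoid" if "s \<in> {0..1}" "z \<in> topspace solenoid" for s z
    using h that by (auto simp: continuous_map_def Pi_iff)
  have q: "continuous_map ?X euclidean (q n)" if "n \<ge> 1" for n
  proof -
    have "continuous_map ?X ?X (\<lambda>p. (a, snd p))"
      using a by (auto simp: continuous_map_pairwise o_def intro!: continuous_intros)
    then have "continuous_map ?X euclidean (\<lambda>p. h (a, snd p) n)"
      using continuous_map_compose[OF _ h, of ?X] that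
      by (auto simp: o_def intro: continuous_map_solenoid_coordinate)
    moreover have "continuous_map ?X euclidean (\<lambda>p. h p n)"
      using continuous_map_solenoid_coordinate[OF h that] .
    moreover have "h (a, snd p) n \<noteq> 0" if "p \<in> topspace ?X" for p
      using norm_solenoid[OF hS[OF a] \<open>n \<ge> 1\<close>] that by fastforce
    ultimately show ?thesis
      unfolding q_def continuous_map_atin limitin_canonical_iff by (intro ballI tendsto_divide; blast)
  qed
  define W where "W = {p \<in> topspace ?X. q 1 p \<in> {c. Re c > 0}}"
  have "openin ?X W"
    unfolding W_def by (rule openin_continuous_map_preimage[OF q]) (auto simp: open_halfspace_Re_gt)
  moreover have q_a: "q n (a, z) = 1" if "n \<ge> 1" "z \<in> topspace solenoid" for n z
    using norm_solenoid[OF hS[OF a that(2)] that(1)] by (auto simp: q_def)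
  then have "{a} \<times> topspace solenoid \<subseteq> W"
    using a by (auto simp: W_def)
  ultimately obtain T V where T: "openin (top_of_set {0..1}) T" "a \<in> T"
    and V: "topspace solenoid \<subseteq> V" and TV: "T \<times> V \<subseteq> W"
    using tube_lemma_right[of "top_of_set {0..1::real}" solenoid W "topspace solenoid" a]
      compact_space_solenoid[unfolded compact_space_def] a
    by (metis topspace_euclidean_subtopology)
  \<comment> \<open>pass to an interval, so that every time in it is joined to \<open>a\<close> by a connected set\<close>
  obtain e where "e > 0" and e: "ball a e \<inter> {0..1} \<subseteq> T"
    using T unfolding openin_contains_ball by blast
  let ?B = "ball a e \<inter> {0..1}"
  have "leafwise_translate (\<lambda>z. h (a, z)) (\<lambda>z. h (s, z))" if s: "s \<in> ?B" for s
  proof -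
    have s01: "s \<in> {0..1}" using s by auto
    have pos: "Re (q 1 (u, z)) > 0" if "u \<in> ?B" "z \<in> topspace solenoid" for u z
      using TV V e that unfolding W_def by blast
    define \<theta> where "\<theta> z = Im (Ln (q 1 (s, z)))" for z
    have "continuous_map solenoid euclideanreal \<theta>"
    proof -
      have "continuous_map solenoid ?X (\<lambda>z. (s, z))"
        using s01 by (auto simp: continuous_map_pairwise o_def)
      then have "continuous_map solenoid euclidean (\<lambda>z. q 1 (s, z))"
        using continuous_map_compose[OF _ q[of 1]] by (auto simp: o_def)
      then have "continuous_map solenoid (top_of_set {c. Re c > 0}) (\<lambda>z. q 1 (s, z))"
        using pos[OF s] by (auto simp: continuous_map_in_subtopology)
      moreover have "continuous_map (top_of_set {c. Re c > 0}) euclideanreal (\<lambda>c. Im (Ln c))"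
        by (auto simp: complex_nonpos_Reals_iff intro!: continuous_intros)
      ultimately show ?thesis
        unfolding \<theta>_def by (rule continuous_map_compose[unfolded o_def])
    qed
    moreover have "h (s, z) n = h (a, z) n * exp (\<i> * complex_of_real (\<theta> z / real n))"
      if z: "z \<in> topspace solenoid" and n: "n \<ge> 1" for z n
    proof -
      have q_cont: "continuous_on ?B (\<lambda>u. q m (u, z))" if "m \<ge> 1" for m
      proof -
        have "continuous_map (top_of_set ?B) ?X (\<lambda>u. (u, z))"
          using z by (auto simp: continuous_map_pairwise o_def)
        then show ?thesis
          using continuous_map_compose[OF _ q[OF that], of "top_of_set ?B"] by (auto simp: o_def)
      qed
      have "q n (s, z) = exp (\<i> * complex_of_real (Im (Ln (q 1 (s, z))) / real n))"
      proof (rule root_of_path_in_right_half_plane[where S = ?B and a = a and r = "\<lambda>u. q n (u, z)"])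
        show "connected ?B"
          by (intro convex_connected convex_Int) auto
        show "q n (u, z) ^ n = q 1 (u, z)" if "u \<in> ?B" for u
          using that a z n hS by (simp add: q_def power_divide solenoid_power)
        show "norm (q n (u, z)) = 1" if "u \<in> ?B" for u
          using that a z n hS by (simp add: q_def norm_divide)
      qed (use q_cont pos q_a z n a s \<open>e > 0\<close> in auto)
      moreover have "h (a, z) n \<noteq> 0"
        using norm_solenoid[OF hS[OF a z] n] by auto
      ultimately show ?thesis
        by (simp add: q_def \<theta>_def divide_eq_eq mult.commute)
    qed
    ultimately show ?thesis unfolding leafwise_translate_def by blast
  qed
  moreover have "openin (top_of_set {0..1}) ?B" by (auto simp: openin_open)
  moreover have "a \<in> ?B" using a \<open>e > 0\<close> by auto
  ultimately show ?thesis by blast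
qed

lemma homotopic_imp_leafwise_translate:
  assumes "homotopic_with (\<lambda>_. True) solenoid solenoid f g"
  shows "leafwise_translate f g"
proof -
  obtain h where h: "continuous_map (prod_topology (top_of_set {0..1::real}) solenoid) solenoid h"
    and ends: "\<And>z. h (0, z) = f z" "\<And>z. h (1, z) = g z"
    using assms unfolding homotopic_with_def by blast
  let ?R = "\<lambda>s t. leafwise_translate (\<lambda>z. h (s, z)) (\<lambda>z. h (t, z))"
  have "?R 0 1"
  proof (rule connected_equivalence_relation[of "{0..1::real}" 0 1 ?R])
    show "?R t s" if "?R s t" for s t
      using that by (rule leafwise_translate_sym)
    show "?R r t" if "?R r s" "?R s t" for r s t
      using that by (rule leafwise_translate_trans)
  qed (use leafwise_translate_nearby_stages[OF h] in auto)
  then show ?thesis by (simp add: ends)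
qed

section \<open>Invariance of the degree\<close>

text \<open>
  The definite description of the lift denotes: a lift exists pointwise by leaf preservation and is
  unique by injectivity of the parametrisation.
\<close>

lemma baseleaf_map_leaf_lift:
  assumes "baseleaf_preserving f"
  shows "f (baseleaf_map x) = baseleaf_map (leaf_lift f x)"
proof -
  have "\<forall>x. \<exists>y. f (baseleaf_map x) = baseleaf_map y"
    using assms unfolding baseleaf_preserving_def by blast
  then obtain f0 where f0: "\<And>x. f (baseleaf_map x) = baseleaf_map (f0 x)" by metis
  have "f \<circ> baseleaf_map = baseleaf_map \<circ> leaf_lift f"
    unfolding leaf_lift_def
  proof (rule theI[of _ f0])
    show "f \<circ> baseleaf_map = baseleaf_map \<circ> f0" using f0 by auto
    show "k = f0" if "f \<circ> baseleaf_map = baseleaf_map \<circ> k" for k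
      using that f0 inj_baseleaf_map by (auto simp: fun_eq_iff inj_def)
  qed
  from fun_cong[OF this, of x] show ?thesis by simp
qed

lemma leaf_lift_leafwise_translate:
  assumes "baseleaf_preserving f" "baseleaf_preserving g" "leafwise_translate f g"
  shows "\<exists>k. continuous_on UNIV k \<and> limit_periodic k \<and> (\<forall>x. leaf_lift g x = leaf_lift f x + k x)"
proof -
  obtain \<theta> where \<theta>: "continuous_map solenoid euclideanreal \<theta>"
    and fg: "\<forall>z\<in>topspace solenoid. \<forall>n\<ge>1. g z n = f z n * exp (\<i> * complex_of_real (\<theta> z / real n))"
    using assms(3) unfolding leafwise_translate_def by blast
  have "baseleaf_map (leaf_lift g x) = baseleaf_map (leaf_lift f x + \<theta> (baseleaf_map x))" for x
  proof
    fix n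
    show "baseleaf_map (leaf_lift g x) n = baseleaf_map (leaf_lift f x + \<theta> (baseleaf_map x)) n"
    proof (cases "n \<ge> 1")
      case True
      have "baseleaf_map (leaf_lift g x) n
          = baseleaf_map (leaf_lift f x) n * exp (\<i> * complex_of_real (\<theta> (baseleaf_map x) / real n))"
        using fg[rule_format, OF baseleaf_map_in_solenoid True, of x]
        unfolding baseleaf_map_leaf_lift[OF assms(1)] baseleaf_map_leaf_lift[OF assms(2)] .
      then show ?thesis
        using True by (simp add: add_divide_distrib distrib_left flip: exp_add)
    qed (simp add: baseleaf_map_def)
  qed
  then have "leaf_lift g x = leaf_lift f x + (\<theta> \<circ> baseleaf_map) x" for x
    using inj_baseleaf_map by (auto simp: inj_def)
  moreover have "continuous_on UNIV (\<theta> \<circ> baseleaf_map)"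
    using continuous_map_compose[OF continuous_map_baseleaf_map \<theta>] by simp
  ultimately show ?thesis
    using limit_periodic_comp_baseleaf_map[OF \<theta>] by blast
qed

text \<open>The condition on \<open>q\<close> whose definite description is the degree.\<close>

definition has_leaf_slope :: "((nat \<Rightarrow> complex) \<Rightarrow> nat \<Rightarrow> complex) \<Rightarrow> rat \<Rightarrow> bool" where
  "has_leaf_slope f q \<longleftrightarrow> (\<exists>h. continuous_on UNIV h \<and> limit_periodic h \<and>
     (\<forall>x. leaf_lift f x = of_rat q * x + h x))"

lemma has_leaf_slope_leafwise_translate:
  assumes "baseleaf_preserving f" "baseleaf_preserving g" "leafwise_translate f g"
    and "has_leaf_slope f q"
  shows "has_leaf_slope g q"
proof -
  obtain h where h: "continuous_on UNIV h" "limit_periodic h"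
    and f: "\<forall>x. leaf_lift f x = of_rat q * x + h x"
    using assms(4) unfolding has_leaf_slope_def by blast
  obtain k where k: "continuous_on UNIV k" "limit_periodic k"
    and g: "\<forall>x. leaf_lift g x = leaf_lift f x + k x"
    using leaf_lift_leafwise_translate[OF assms(1-3)] by blast
  have "\<forall>x. leaf_lift g x = of_rat q * x + (h x + k x)"
    using f g by simp
  with continuous_on_add[OF h(1) k(1)] limit_periodic_add[OF h(2) k(2)] show ?thesis
    unfolding has_leaf_slope_def by blast
qed

theorem proposition4p2:
  fixes f f' :: "(nat \<Rightarrow> complex) \<Rightarrow> nat \<Rightarrow> complex"
  assumes "continuous_map solenoid solenoid f"
    and "continuous_map solenoid solenoid f'"
    and "baseleaf_preserving f"
    and "baseleaf_preserving f'"
    and "homotopic_with (\<lambda>_. True) solenoid solenoid f f'"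
  shows "solenoid_degree f = solenoid_degree f'"
proof -
  have tr: "leafwise_translate f f'"
    using assms(5) by (rule homotopic_imp_leafwise_translate)
  have "has_leaf_slope f q \<longleftrightarrow> has_leaf_slope f' q" for q
  proof
    show "has_leaf_slope f' q" if "has_leaf_slope f q"
      using has_leaf_slope_leafwise_translate[OF assms(3,4) tr that] .
    show "has_leaf_slope f q" if "has_leaf_slope f' q"
      using has_leaf_slope_leafwise_translate[OF assms(4,3) leafwise_translate_sym[OF tr] that] .
  qed
  then have "(THE q. has_leaf_slope f q) = (THE q. has_leaf_slope f' q)"
    by simp
  then show ?thesis
    unfolding solenoid_degree_def has_leaf_slope_def .
qed

end
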